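(* Let $p\in[1,+\infty)$. If $f\colon\mathbb R\to\mathbb R$ is quasi continuously differentiable with exponent $\frac1p$, then the composition operator $C_f$ maps $bv_1(\mathbb R)$ into $bv_p(\mathbb R)$ and is locally uniformly continuous.
   Context: Let $\alpha\in(0,1]$. A function $f\colon\mathbb R\to\mathbb R$ is called quasi continuously differentiable with exponent $\alpha$ if for every $r>0$ and $\varepsilon>0$ there exists $\delta>0$ such that for all $a,b,c,d\in[-r,r]$ with $a\ne b$, $c\ne d$, $|a-c|\le\delta$ and $|b-d|\le\delta$ one has \[ \left|\frac{(f(a)-f(b))(a-b)}{|a-b|^{1+\alpha}}-\frac{(f(c)-f(d))(c-d)}{|c-d|^{1+\alpha}}\right|\le\varepsilon. \] The composition operator $C_f$ assigns to a sequence $x\colon\mathbb N\to\mathbb R$ the sequence $C_f(x)$ with $C_f(x)(n)=f(x(n))$ for all $n\in\mathbb N$. For $p\in[1,+\infty)$, $bv_p(\mathbb R)$ is the space of all sequences $x\colon\mathbb N\to\mathbb R$ with $\sum_{n=1}^\infty|x(n+1)-x(n)|^p<+\infty$, with norm $\|x\|_{bv_p}=|x(1)|+\bigl(\sum_{n=1}^\infty|x(n+1)-x(n)|^p\bigr)^{1/p}$. A map between normed spaces is called locally uniformly continuous if it is uniformly continuous on every bounded subset of its domain. *)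

theory Defs
  imports "HOL-Analysis.Analysis"
begin

definition quasi_cont_diff :: "real \<Rightarrow> (real \<Rightarrow> real) \<Rightarrow> bool" where
  "quasi_cont_diff \<alpha> f \<longleftrightarrow>
    (\<forall>r>0. \<forall>\<epsilon>>0. \<exists>\<delta>>0. \<forall>a\<in>{-r..r}. \<forall>b\<in>{-r..r}. \<forall>c\<in>{-r..r}. \<forall>d\<in>{-r..r}.
      a \<noteq> b \<longrightarrow> c \<noteq> d \<longrightarrow> \<bar>a - c\<bar> \<le> \<delta> \<longrightarrow> \<bar>b - d\<bar> \<le> \<delta> \<longrightarrow>
      \<bar>((f a - f b) * (a - b)) / \<bar>a - b\<bar> powr (1 + \<alpha>)
        - ((f c - f d) * (c - d)) / \<bar>c - d\<bar> powr (1 + \<alpha>)\<bar> \<le> \<epsilon>)"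

definition comp_op :: "(real \<Rightarrow> real) \<Rightarrow> (nat \<Rightarrow> real) \<Rightarrow> (nat \<Rightarrow> real)" where
  "comp_op f x = (\<lambda>n. f (x n))"

(* Sequences are indexed from 0, so x 0 is the first term. *)

definition bv :: "real \<Rightarrow> (nat \<Rightarrow> real) set" where
  "bv p = {x. summable (\<lambda>n. \<bar>x (Suc n) - x n\<bar> powr p)}"

definition bv_norm :: "real \<Rightarrow> (nat \<Rightarrow> real) \<Rightarrow> real" where
  "bv_norm p x = \<bar>x 0\<bar> + (\<Sum>n. \<bar>x (Suc n) - x n\<bar> powr p) powr (1 / p)"

(* The normed spaces bv p depend on the real parameter p, so they are carrier sets with
   an explicit norm rather than types of class real_normed_vector. X is the domain, normed
   by nX; nY is the norm of the codomain. The difference of two sequences is the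
   pointwise one. *)
definition locally_uniformly_continuous ::
  "'a::minus set \<Rightarrow> ('a \<Rightarrow> real) \<Rightarrow> ('b::minus \<Rightarrow> real) \<Rightarrow> ('a \<Rightarrow> 'b) \<Rightarrow> bool" where
  "locally_uniformly_continuous X nX nY F \<longleftrightarrow>
    (\<forall>B\<subseteq>X. (\<exists>M. \<forall>x\<in>B. nX x \<le> M) \<longrightarrow>
      (\<forall>\<epsilon>>0. \<exists>\<delta>>0. \<forall>x\<in>B. \<forall>y\<in>B. nX (x - y) < \<delta> \<longrightarrow> nY (F x - F y) < \<epsilon>))"

end

(* Write f a - f b = q (a, b) * sgn (a - b) * |a - b|^(1/p). On a square [-r, r]^2 the quotient
   q is uniformly continuous off the diagonal, hence bounded there by some L; so f is Hoelder
   continuous with exponent 1/p on bounded sets, which gives C_f (bv_1) <= bv_p.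
   If x and y are uniformly close, the increments of C_f x - C_f y split as
   (q_x - q_y) * s (dx) + q_y * (s (dx) - s (dy)) with s t = sgn t * |t|^(1/p). The first summand
   is small relative to |dx|^(1/p), the second is at most 2 L |dx - dy|^(1/p), so the sum of
   p-th powers is controlled by a small multiple of the variation of x plus a constant times
   the variation of x - y. *)

theory Submission
  imports Defs
begin

section \<open>Elementary inequalities for real powers\<close>

lemma powr_add_le_add_powr:
  fixes a b \<alpha> :: real
  assumes "0 \<le> a" "0 \<le> b" "\<alpha> \<le> 1"
  shows "(a + b) powr \<alpha> \<le> a powr \<alpha> + b powr \<alpha>"
proof (cases "a = 0 \<or> b = 0")
  case False
  with assms have pos: "0 < a" "0 < b" by auto
  have "(a + b) powr \<alpha> = a * (a + b) powr (\<alpha> - 1) + b * (a + b) powr (\<alpha> - 1)"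
    using pos powr_add[of "a + b" 1 "\<alpha> - 1"] by (simp add: distrib_right)
  \<comment> \<open>As \<open>\<alpha> - 1 \<le> 0\<close>, the power decreases in its base, so
    replacing \<open>a + b\<close> by \<open>a\<close> or \<open>b\<close> can only enlarge each
    term.\<close>
  also have "\<dots> \<le> a * a powr (\<alpha> - 1) + b * b powr (\<alpha> - 1)"
    using pos assms by (intro add_mono mult_left_mono powr_mono2') auto
  also have "\<dots> = a powr \<alpha> + b powr \<alpha>"
    using pos by (simp add: powr_diff)
  finally show ?thesis .
qed auto

text \<open>Subadditivity applied to the larger number, written as the smaller one plus the
  difference.\<close>

lemma powr_diff_abs_le:
  fixes a b \<alpha> :: real
  assumes "0 \<le> a" "0 \<le> b" "0 \<le> \<alpha>" "\<alpha> \<le> 1"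
  shows "\<bar>a powr \<alpha> - b powr \<alpha>\<bar> \<le> \<bar>a - b\<bar> powr \<alpha>"
  using assms(1,2)
proof (induction a b rule: linorder_wlog)
  case (le a b)
  then have "a powr \<alpha> \<le> b powr \<alpha>"
    using assms(3) by (intro powr_mono2)
  then show ?case
    using le powr_add_le_add_powr[of a "b - a" \<alpha>] assms(4) by simp
next
  case (sym a b)
  then show ?case
    by (simp add: abs_minus_commute)
qed

text \<open>For equal signs this is the estimate for absolute values. Otherwise zero lies between
  \<open>u\<close> and \<open>v\<close>, so both absolute values are at most
  \<open>\<bar>u - v\<bar>\<close>; the factor 2 comes from adding these two bounds.\<close>

lemma sgn_powr_diff_le:
  fixes u v \<alpha> :: real
  assumes "0 \<le> \<alpha>" "\<alpha> \<le> 1"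
  shows "\<bar>sgn u * \<bar>u\<bar> powr \<alpha> - sgn v * \<bar>v\<bar> powr \<alpha>\<bar> \<le> 2 * \<bar>u - v\<bar> powr \<alpha>"
proof (cases "0 < u * v")
  case True
  then have "\<bar>sgn u * \<bar>u\<bar> powr \<alpha> - sgn v * \<bar>v\<bar> powr \<alpha>\<bar> = \<bar>\<bar>u\<bar> powr \<alpha> - \<bar>v\<bar> powr \<alpha>\<bar>"
    by (auto simp: zero_less_mult_iff)
  also have "\<dots> \<le> \<bar>\<bar>u\<bar> - \<bar>v\<bar>\<bar> powr \<alpha>"
    using assms by (intro powr_diff_abs_le) auto
  also have "\<dots> = \<bar>u - v\<bar> powr \<alpha>"
    using True by (auto simp: zero_less_mult_iff abs_minus_commute)
  finally show ?thesis
    using powr_ge_zero[of "\<bar>u - v\<bar>" \<alpha>] by linarith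
next
  case False
  then have "\<bar>u\<bar> \<le> \<bar>u - v\<bar>" "\<bar>v\<bar> \<le> \<bar>u - v\<bar>"
    by (auto simp: zero_less_mult_iff)
  then have "\<bar>u\<bar> powr \<alpha> \<le> \<bar>u - v\<bar> powr \<alpha>" "\<bar>v\<bar> powr \<alpha> \<le> \<bar>u - v\<bar> powr \<alpha>"
    using assms by (auto intro: powr_mono2)
  moreover have "\<bar>sgn w * \<bar>w\<bar> powr \<alpha>\<bar> \<le> \<bar>w\<bar> powr \<alpha>" for w :: real
    by (simp add: abs_mult sgn_if)
  ultimately show ?thesis
    using abs_triangle_ineq4[of "sgn u * \<bar>u\<bar> powr \<alpha>" "sgn v * \<bar>v\<bar> powr \<alpha>"] by (smt (verit))
qed

text \<open>A crude bound through \<open>a + b \<le> 2 * max a b\<close>. It takes the place of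
  Minkowski's inequality below, where the constant \<open>2 powr p\<close> is absorbed by the choice
  of parameters.\<close>

lemma add_powr_le:
  fixes a b p :: real
  assumes "0 \<le> a" "0 \<le> b" "0 \<le> p"
  shows "(a + b) powr p \<le> 2 powr p * (a powr p + b powr p)"
proof -
  have "(a + b) powr p \<le> (2 * max a b) powr p"
    using assms by (intro powr_mono2) auto
  also have "\<dots> = 2 powr p * max a b powr p"
    using assms by (simp add: powr_mult)
  also have "\<dots> \<le> 2 powr p * (a powr p + b powr p)"
    by (intro mult_left_mono) (auto simp: max_def)
  finally show ?thesis .
qed

section \<open>The Hoelder quotient and its bounds on squares\<close>

definition hoelder_quot :: "real \<Rightarrow> (real \<Rightarrow> real) \<Rightarrow> real \<times> real \<Rightarrow> real" where
  "hoelder_quot \<alpha> f = (\<lambda>(a, b). (f a - f b) * (a - b) / \<bar>a - b\<bar> powr (1 + \<alpha>))"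

lemma diff_eq_hoelder_quot:
  assumes "a \<noteq> b"
  shows "f a - f b = hoelder_quot \<alpha> f (a, b) * (sgn (a - b) * \<bar>a - b\<bar> powr \<alpha>)"
proof -
  have "\<bar>a - b\<bar> powr (1 + \<alpha>) = \<bar>a - b\<bar> * \<bar>a - b\<bar> powr \<alpha>"
    using assms by (simp add: powr_add)
  moreover have "(a - b) * sgn (a - b) = \<bar>a - b\<bar>"
    by (simp add: abs_sgn)
  moreover have "hoelder_quot \<alpha> f (a, b) * (sgn (a - b) * \<bar>a - b\<bar> powr \<alpha>)
      = (f a - f b) * ((a - b) * sgn (a - b)) * \<bar>a - b\<bar> powr \<alpha> / \<bar>a - b\<bar> powr (1 + \<alpha>)"
    by (simp add: hoelder_quot_def mult_ac)
  ultimately show ?thesis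
    using assms by simp
qed

lemma quasi_cont_diffE:
  assumes "quasi_cont_diff \<alpha> f" "0 < r" "0 < e"
  obtains d where "0 < d"
    "\<And>a b a' b'. \<lbrakk>a \<in> {-r..r}; b \<in> {-r..r}; a' \<in> {-r..r}; b' \<in> {-r..r};
      a \<noteq> b; a' \<noteq> b'; \<bar>a - a'\<bar> \<le> d; \<bar>b - b'\<bar> \<le> d\<rbrakk>
      \<Longrightarrow> \<bar>hoelder_quot \<alpha> f (a, b) - hoelder_quot \<alpha> f (a', b')\<bar> \<le> e"
proof -
  obtain d where d: "0 < d \<and> (\<forall>a\<in>{-r..r}. \<forall>b\<in>{-r..r}. \<forall>a'\<in>{-r..r}. \<forall>b'\<in>{-r..r}.
      a \<noteq> b \<longrightarrow> a' \<noteq> b' \<longrightarrow> \<bar>a - a'\<bar> \<le> d \<longrightarrow> \<bar>b - b'\<bar> \<le> d \<longrightarrow>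
      \<bar>hoelder_quot \<alpha> f (a, b) - hoelder_quot \<alpha> f (a', b')\<bar> \<le> e)"
    using assms(1)[unfolded quasi_cont_diff_def, THEN spec, THEN mp, OF assms(2), THEN spec, THEN mp, OF assms(3)]
    unfolding hoelder_quot_def split_conv by (rule exE)
  show ?thesis
    by (rule that[of d]) (use d in blast)+
qed

lemma quasi_cont_diff_uniformly_continuous:
  assumes "quasi_cont_diff \<alpha> f" "0 < r"
  shows "uniformly_continuous_on {(a, b). a \<in> {-r..r} \<and> b \<in> {-r..r} \<and> a \<noteq> b} (hoelder_quot \<alpha> f)"
  unfolding uniformly_continuous_on_def
proof (intro allI impI)
  fix e :: real
  assume "0 < e"
  \<comment> \<open>Quasi continuous differentiability yields a non-strict bound; asking for
    \<open>e / 2\<close> makes it strict.\<close>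
  then obtain d where "0 < d" and d: "\<And>a b a' b'. \<lbrakk>a \<in> {-r..r}; b \<in> {-r..r}; a' \<in> {-r..r}; b' \<in> {-r..r};
      a \<noteq> b; a' \<noteq> b'; \<bar>a - a'\<bar> \<le> d; \<bar>b - b'\<bar> \<le> d\<rbrakk>
      \<Longrightarrow> \<bar>hoelder_quot \<alpha> f (a, b) - hoelder_quot \<alpha> f (a', b')\<bar> \<le> e / 2"
    using quasi_cont_diffE[OF assms half_gt_zero] by blast
  have "dist (hoelder_quot \<alpha> f z') (hoelder_quot \<alpha> f z) < e"
    if "z \<in> {(a, b). a \<in> {-r..r} \<and> b \<in> {-r..r} \<and> a \<noteq> b}"
      "z' \<in> {(a, b). a \<in> {-r..r} \<and> b \<in> {-r..r} \<and> a \<noteq> b}" "dist z' z < d" for z z'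
  proof -
    obtain a b a' b' where z: "z = (a, b)" "z' = (a', b')"
      by (cases z, cases z')
    have "\<bar>a' - a\<bar> \<le> d" "\<bar>b' - b\<bar> \<le> d"
      using that(3) dist_fst_le[of z' z] dist_snd_le[of z' z] by (auto simp: z dist_real_def)
    then have "\<bar>hoelder_quot \<alpha> f (a', b') - hoelder_quot \<alpha> f (a, b)\<bar> \<le> e / 2"
      using d that(1,2) by (simp add: z)
    with \<open>0 < e\<close> show ?thesis
      by (simp add: z dist_real_def)
  qed
  with \<open>0 < d\<close> show "\<exists>d>0. \<forall>x\<in>{(a, b). a \<in> {-r..r} \<and> b \<in> {-r..r} \<and> a \<noteq> b}.
      \<forall>x'\<in>{(a, b). a \<in> {-r..r} \<and> b \<in> {-r..r} \<and> a \<noteq> b}. dist x' x < d \<longrightarrow>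
        dist (hoelder_quot \<alpha> f x') (hoelder_quot \<alpha> f x) < e"
    by blast
qed

lemma quasi_cont_diff_quot_bounded:
  assumes "quasi_cont_diff \<alpha> f" "0 < r"
  obtains L where "1 \<le> L"
    "\<And>a b. \<lbrakk>\<bar>a\<bar> \<le> r; \<bar>b\<bar> \<le> r; a \<noteq> b\<rbrakk> \<Longrightarrow> \<bar>hoelder_quot \<alpha> f (a, b)\<bar> \<le> L"
proof -
  define S where "S = {(a, b). a \<in> {-r..r} \<and> b \<in> {-r..r} \<and> a \<noteq> b}"
  have "S \<subseteq> {-r..r} \<times> {-r..r}"
    by (auto simp: S_def)
  then have "bounded S"
    by (rule bounded_subset[rotated]) (intro bounded_Times bounded_closed_interval)
  then have "bounded (hoelder_quot \<alpha> f ` S)"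
    using quasi_cont_diff_uniformly_continuous[OF assms]
    by (intro bounded_uniformly_continuous_image) (auto simp: S_def)
  then obtain K where K: "\<And>z. z \<in> S \<Longrightarrow> \<bar>hoelder_quot \<alpha> f z\<bar> \<le> K"
    by (auto simp: bounded_iff)
  show ?thesis
  proof (rule that[of "max 1 K"])
    show "\<bar>hoelder_quot \<alpha> f (a, b)\<bar> \<le> max 1 K" if "\<bar>a\<bar> \<le> r" "\<bar>b\<bar> \<le> r" "a \<noteq> b" for a b
      using K[of "(a, b)"] that by (auto simp: S_def abs_le_iff)
  qed simp
qed

text \<open>Off the diagonal, the modulus of the quotient is the Hoelder ratio of \<open>f\<close>;
  on the diagonal both sides vanish because \<open>0 powr \<alpha> = 0\<close>.\<close>

lemma hoelder_of_quot_bound: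
  assumes "a \<noteq> b \<Longrightarrow> \<bar>hoelder_quot \<alpha> f (a, b)\<bar> \<le> L"
  shows "\<bar>f a - f b\<bar> \<le> L * \<bar>a - b\<bar> powr \<alpha>"
proof (cases "a = b")
  case False
  have "\<bar>f a - f b\<bar> = \<bar>hoelder_quot \<alpha> f (a, b)\<bar> * \<bar>a - b\<bar> powr \<alpha>"
    using False by (subst diff_eq_hoelder_quot[of a b f \<alpha>]) (auto simp: abs_mult sgn_if)
  then show ?thesis
    using assms False by (simp add: mult_right_mono)
qed simp

section \<open>Sequences of bounded variation\<close>

lemma bv_1_iff: "x \<in> bv 1 \<longleftrightarrow> summable (\<lambda>n. \<bar>x (Suc n) - x n\<bar>)"
  by (simp add: bv_def)

text \<open>Membership makes the series summable, hence its sum nonnegative, and on such a number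
  the outer exponent \<open>1 / 1\<close> acts trivially.\<close>

lemma bv_norm_1: "bv_norm 1 x = \<bar>x 0\<bar> + (\<Sum>n. \<bar>x (Suc n) - x n\<bar>)" if "x \<in> bv 1"
  using that suminf_nonneg[of "\<lambda>n. \<bar>x (Suc n) - x n\<bar>"] by (simp add: bv_norm_def bv_1_iff)

text \<open>By telescoping, \<open>x n\<close> is \<open>x 0\<close> plus the first \<open>n\<close>
  increments. Thus a bounded set in \<open>bv 1\<close> takes its values in one interval, and
  closeness in norm is uniform closeness.\<close>

lemma abs_le_bv_norm_1:
  assumes "x \<in> bv 1"
  shows "\<bar>x n\<bar> \<le> bv_norm 1 x"
proof -
  have "\<bar>x n\<bar> \<le> \<bar>x 0\<bar> + (\<Sum>k<n. \<bar>x (Suc k) - x k\<bar>)"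
    by (induction n) auto
  also have "(\<Sum>k<n. \<bar>x (Suc k) - x k\<bar>) \<le> (\<Sum>k. \<bar>x (Suc k) - x k\<bar>)"
    using assms by (intro sum_le_suminf) (auto simp: bv_1_iff)
  finally show ?thesis
    using bv_norm_1[OF assms] by linarith
qed

lemma diff_mem_bv_1:
  assumes "x \<in> bv 1" "y \<in> bv 1"
  shows "x - y \<in> bv 1"
proof -
  have "summable (\<lambda>n. \<bar>x (Suc n) - x n\<bar> + \<bar>y (Suc n) - y n\<bar>)"
    using assms by (intro summable_add) (auto simp: bv_1_iff)
  then show ?thesis
    unfolding bv_1_iff
    by (rule summable_comparison_test_ev[rotated]) (auto intro!: always_eventually)
qed

section \<open>The composition operator maps \<open>bv 1\<close> into \<open>bv p\<close>\<close>

lemma comp_op_mem_bv: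
  assumes p: "1 \<le> p" and f: "quasi_cont_diff (1 / p) f" and x: "x \<in> bv 1"
  shows "comp_op f x \<in> bv p"
proof -
  \<comment> \<open>The added 1 keeps the radius positive even for the zero sequence.\<close>
  have "0 < bv_norm 1 x + 1"
    using abs_le_bv_norm_1[OF x, of 0] by linarith
  then obtain L where L: "1 \<le> L" "\<And>a b. \<lbrakk>\<bar>a\<bar> \<le> bv_norm 1 x + 1; \<bar>b\<bar> \<le> bv_norm 1 x + 1; a \<noteq> b\<rbrakk>
      \<Longrightarrow> \<bar>hoelder_quot (1 / p) f (a, b)\<bar> \<le> L"
    using quasi_cont_diff_quot_bounded[OF f] by blast
  have bound: "\<bar>x n\<bar> \<le> bv_norm 1 x + 1" for n
    using abs_le_bv_norm_1[OF x, of n] by linarith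
  \<comment> \<open>The \<open>p\<close>-th power undoes the Hoelder exponent \<open>1 / p\<close>,
    leaving a multiple of the increment of \<open>x\<close>.\<close>
  have le: "\<bar>f (x (Suc n)) - f (x n)\<bar> powr p \<le> L powr p * \<bar>x (Suc n) - x n\<bar>" for n
  proof -
    have "\<bar>f (x (Suc n)) - f (x n)\<bar> powr p \<le> (L * \<bar>x (Suc n) - x n\<bar> powr (1 / p)) powr p"
      using p bound L by (intro powr_mono2 hoelder_of_quot_bound) auto
    also have "\<dots> = L powr p * \<bar>x (Suc n) - x n\<bar>"
      using p L by (simp add: powr_mult powr_powr)
    finally show ?thesis .
  qed
  have "summable (\<lambda>n. L powr p * \<bar>x (Suc n) - x n\<bar>)"
    using x by (intro summable_mult) (simp add: bv_1_iff)
  then show ?thesis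
    unfolding bv_def comp_op_def mem_Collect_eq
    by (rule summable_comparison_test_ev[rotated]) (auto intro!: always_eventually le)
qed

section \<open>Local uniform continuity\<close>

lemma increment_diff_le:
  assumes \<alpha>: "0 \<le> \<alpha>" "\<alpha> \<le> 1" and "0 \<le> e"
    and L: "a \<noteq> b \<Longrightarrow> \<bar>hoelder_quot \<alpha> f (a, b)\<bar> \<le> L" "c \<noteq> d \<Longrightarrow> \<bar>hoelder_quot \<alpha> f (c, d)\<bar> \<le> L"
    and close: "\<lbrakk>a \<noteq> b; c \<noteq> d\<rbrakk> \<Longrightarrow> \<bar>hoelder_quot \<alpha> f (a, b) - hoelder_quot \<alpha> f (c, d)\<bar> \<le> e"
    and "0 \<le> L"
  shows "\<bar>(f a - f b) - (f c - f d)\<bar>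
    \<le> e * \<bar>a - b\<bar> powr \<alpha> + 2 * L * \<bar>(a - b) - (c - d)\<bar> powr \<alpha>"
proof -
  \<comment> \<open>Closeness of the quotients is available only off the diagonal. If one increment
    vanishes, the Hoelder estimate for the other one suffices.\<close>
  consider "a = b" | "c = d" | "a \<noteq> b" "c \<noteq> d" by blast
  then show ?thesis
  proof cases
    case 1
    then have "\<bar>(f a - f b) - (f c - f d)\<bar> \<le> L * \<bar>(a - b) - (c - d)\<bar> powr \<alpha>"
      using hoelder_of_quot_bound[of c d \<alpha> f L, OF L(2)] by (simp add: abs_minus_commute)
    also have "\<dots> \<le> 2 * L * \<bar>(a - b) - (c - d)\<bar> powr \<alpha>"
      using \<open>0 \<le> L\<close> by (intro mult_right_mono) auto
    finally show ?thesis
      using 1 by simp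
  next
    case 2
    then have "\<bar>(f a - f b) - (f c - f d)\<bar> \<le> L * \<bar>(a - b) - (c - d)\<bar> powr \<alpha>"
      using hoelder_of_quot_bound[of a b \<alpha> f L, OF L(1)] by simp
    also have "\<dots> \<le> 2 * L * \<bar>(a - b) - (c - d)\<bar> powr \<alpha>"
      using \<open>0 \<le> L\<close> by (intro mult_right_mono) auto
    finally show ?thesis
      using \<open>0 \<le> e\<close> by (simp add: add_increasing)
  next
    case 3
    define q q' where "q = hoelder_quot \<alpha> f (a, b)" and "q' = hoelder_quot \<alpha> f (c, d)"
    define s s' where "s = sgn (a - b) * \<bar>a - b\<bar> powr \<alpha>" and "s' = sgn (c - d) * \<bar>c - d\<bar> powr \<alpha>"
    have "(f a - f b) - (f c - f d) = q * s - q' * s'"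
      using diff_eq_hoelder_quot[of a b f \<alpha>] diff_eq_hoelder_quot[of c d f \<alpha>] 3
      by (simp add: q_def q'_def s_def s'_def)
    also have "\<dots> = (q - q') * s + q' * (s - s')"
      by (simp add: algebra_simps)
    also have "\<bar>\<dots>\<bar> \<le> \<bar>q - q'\<bar> * \<bar>s\<bar> + \<bar>q'\<bar> * \<bar>s - s'\<bar>"
      by (metis abs_mult abs_triangle_ineq)
    also have "\<dots> \<le> e * \<bar>a - b\<bar> powr \<alpha> + L * (2 * \<bar>(a - b) - (c - d)\<bar> powr \<alpha>)"
    proof (intro add_mono mult_mono)
      show "\<bar>s - s'\<bar> \<le> 2 * \<bar>(a - b) - (c - d)\<bar> powr \<alpha>"
        unfolding s_def s'_def using \<alpha> by (rule sgn_powr_diff_le)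
      show "\<bar>s\<bar> \<le> \<bar>a - b\<bar> powr \<alpha>"
        by (simp add: s_def abs_mult sgn_if)
    qed (use 3 L close \<open>0 \<le> e\<close> \<open>0 \<le> L\<close> in \<open>auto simp: q_def q'_def\<close>)
    finally show ?thesis
      by (simp add: mult_ac)
  qed
qed

lemma comp_op_locally_uniformly_continuous:
  assumes p: "1 \<le> p" and f: "quasi_cont_diff (1 / p) f"
  shows "locally_uniformly_continuous (bv 1) (bv_norm 1) (bv_norm p) (comp_op f)"
  unfolding locally_uniformly_continuous_def
proof (intro allI impI)
  fix B :: "(nat \<Rightarrow> real) set" and \<epsilon> :: real
  assume B: "B \<subseteq> bv 1" "\<exists>M. \<forall>x\<in>B. bv_norm 1 x \<le> M" and \<epsilon>: "0 < \<epsilon>"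
  then obtain M where M: "\<And>x. x \<in> B \<Longrightarrow> bv_norm 1 x \<le> M" by blast
  \<comment> \<open>This \<open>r\<close> is positive and bounds both the terms and the total
    variation of every sequence in \<open>B\<close>.\<close>
  define r where "r = max 1 M"
  have r: "0 < r" "\<And>x. x \<in> B \<Longrightarrow> bv_norm 1 x \<le> r"
    using M by (auto simp: r_def intro: le_max_iff_disj[THEN iffD2])
  obtain L where L: "1 \<le> L"
      "\<And>a b. \<lbrakk>\<bar>a\<bar> \<le> r; \<bar>b\<bar> \<le> r; a \<noteq> b\<rbrakk> \<Longrightarrow> \<bar>hoelder_quot (1 / p) f (a, b)\<bar> \<le> L"
    using quasi_cont_diff_quot_bounded[OF f r(1)] by blast
  \<comment> \<open>Chosen so that \<open>(2 * e) powr p * r\<close> is half of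
    \<open>(\<epsilon> / 4) powr p\<close>.\<close>
  define e where "e = \<epsilon> / 8 / (2 * r) powr (1 / p)"
  have e: "0 < e" using \<epsilon> r by (simp add: e_def)
  obtain d where d: "0 < d" "\<And>a b a' b'. \<lbrakk>a \<in> {-r..r}; b \<in> {-r..r}; a' \<in> {-r..r}; b' \<in> {-r..r};
      a \<noteq> b; a' \<noteq> b'; \<bar>a - a'\<bar> \<le> d; \<bar>b - b'\<bar> \<le> d\<rbrakk>
      \<Longrightarrow> \<bar>hoelder_quot (1 / p) f (a, b) - hoelder_quot (1 / p) f (a', b')\<bar> \<le> e"
    using quasi_cont_diffE[OF f r(1) e] by blast
  \<comment> \<open>The entry \<open>d\<close> makes the quotients \<open>e\<close>-close. The other
    entry, multiplied by \<open>(4 * L) powr p\<close>, gives the remaining half of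
    \<open>(\<epsilon> / 4) powr p\<close>.\<close>
  define \<delta> where "\<delta> = min d ((\<epsilon> / (16 * L)) powr p / 2)"
  have \<delta>: "0 < \<delta>" using d \<epsilon> L by (simp add: \<delta>_def)
  have "bv_norm p (comp_op f x - comp_op f y) < \<epsilon>"
    if xy: "x \<in> B" "y \<in> B" "bv_norm 1 (x - y) < \<delta>" for x y
  proof -
    define u where "u = (\<lambda>n. \<bar>x (Suc n) - x n\<bar>)"
    define v where "v n = \<bar>(x (Suc n) - x n) - (y (Suc n) - y n)\<bar>" for n
    define w where "w n = \<bar>(f (x (Suc n)) - f (x n)) - (f (y (Suc n)) - f (y n))\<bar>" for n
    have mem: "x \<in> bv 1" "y \<in> bv 1" "x - y \<in> bv 1"
      using xy(1,2) B(1) by (auto intro: diff_mem_bv_1)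
    have v_eq: "v = (\<lambda>n. \<bar>(x - y) (Suc n) - (x - y) n\<bar>)"
      by (auto simp: v_def)
    have u: "summable u" "suminf u \<le> r"
      using mem(1) r(2)[OF xy(1)] bv_norm_1[OF mem(1)] by (auto simp: u_def bv_1_iff)
    have v: "summable v" "suminf v \<le> \<delta>"
      using mem(3) xy(3) bv_norm_1[OF mem(3)] unfolding v_eq by (auto simp: bv_1_iff)
    have bound: "\<bar>x n\<bar> \<le> r" "\<bar>y n\<bar> \<le> r" for n
      using abs_le_bv_norm_1[OF mem(1), of n] abs_le_bv_norm_1[OF mem(2), of n]
        r(2)[OF xy(1)] r(2)[OF xy(2)] by linarith+
    have close: "\<bar>x n - y n\<bar> \<le> \<delta>" for n
      using abs_le_bv_norm_1[OF mem(3), of n] xy(3) by simp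
    \<comment> \<open>After taking \<open>p\<close>-th powers the bound is linear in
      \<open>u n\<close> and \<open>v n\<close>, so it can be summed over \<open>n\<close>.\<close>
    have w_le: "w n powr p \<le> 2 powr p * (e powr p * u n + (2 * L) powr p * v n)" for n
    proof -
      have "w n \<le> e * u n powr (1 / p) + 2 * L * v n powr (1 / p)"
        unfolding w_def u_def v_def
      proof (rule increment_diff_le)
        show "\<bar>hoelder_quot (1 / p) f (x (Suc n), x n) - hoelder_quot (1 / p) f (y (Suc n), y n)\<bar> \<le> e"
          if "x (Suc n) \<noteq> x n" "y (Suc n) \<noteq> y n"
        proof -
          have "\<bar>x k - y k\<bar> \<le> d" "x k \<in> {-r..r}" "y k \<in> {-r..r}" for k
            using close[of k] bound[of k] by (auto simp: \<delta>_def abs_le_iff)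
          then show ?thesis
            using d(2) that by blast
        qed
      qed (use p e L bound in auto)
      then have "w n powr p \<le> (e * u n powr (1 / p) + 2 * L * v n powr (1 / p)) powr p"
        using p by (intro powr_mono2) (auto simp: w_def)
      also have "\<dots> \<le> 2 powr p * ((e * u n powr (1 / p)) powr p + (2 * L * v n powr (1 / p)) powr p)"
        using p e L by (intro add_powr_le) auto
      also have "\<dots> = 2 powr p * (e powr p * u n + (2 * L) powr p * v n)"
        using p e L by (simp add: powr_mult powr_powr u_def v_def)
      finally show ?thesis .
    qed
    have sm: "summable (\<lambda>n. 2 powr p * (e powr p * u n + (2 * L) powr p * v n))"
      using u v by (intro summable_mult summable_add)
    then have w: "summable (\<lambda>n. w n powr p)"
      by (rule summable_comparison_test_ev[rotated]) (auto intro!: always_eventually w_le)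
    have "(\<Sum>n. w n powr p) \<le> (\<Sum>n. 2 powr p * (e powr p * u n + (2 * L) powr p * v n))"
      using w_le w sm by (rule suminf_le)
    also have "\<dots> = 2 powr p * (e powr p * suminf u + (2 * L) powr p * suminf v)"
      using u v by (simp add: suminf_mult suminf_add[symmetric] summable_add summable_mult)
    also have "\<dots> \<le> 2 powr p * (e powr p * r + (2 * L) powr p * ((\<epsilon> / (16 * L)) powr p / 2))"
      using u v by (intro mult_left_mono add_mono) (auto simp: \<delta>_def)
    also have "\<dots> = (\<epsilon> / 4) powr p"
    proof -
      have "2 powr p * (e powr p * r) = (2 * e) powr p * r"
        using e by (simp add: powr_mult)
      also have "(2 * e) powr p = (\<epsilon> / 4) powr p / (2 * r)"
        using \<epsilon> r p by (simp add: e_def powr_divide powr_mult powr_powr)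
      finally have 1: "2 powr p * (e powr p * r) = (\<epsilon> / 4) powr p / 2"
        using r by simp
      have "2 powr p * ((2 * L) powr p * (\<epsilon> / (16 * L)) powr p)
          = (2 * (2 * L * (\<epsilon> / (16 * L)))) powr p"
        using L \<epsilon> by (simp only: powr_mult)
      also have "2 * (2 * L * (\<epsilon> / (16 * L))) = \<epsilon> / 4"
        using L by simp
      finally show ?thesis
        using 1 by (simp add: distrib_left)
    qed
    finally have "(\<Sum>n. w n powr p) powr (1 / p) \<le> ((\<epsilon> / 4) powr p) powr (1 / p)"
      using p w by (intro powr_mono2 suminf_nonneg) auto
    then have variation: "(\<Sum>n. w n powr p) powr (1 / p) \<le> \<epsilon> / 4"
      using p \<epsilon> by (simp add: powr_powr)
    \<comment> \<open>The initial term of the norm is handled by the Hoelder estimate alone; its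
      share \<open>\<epsilon> / 16\<close> and the share \<open>\<epsilon> / 4\<close> of the
      variation stay strictly below \<open>\<epsilon>\<close>.\<close>
    have "\<bar>f (x 0) - f (y 0)\<bar> \<le> L * \<bar>x 0 - y 0\<bar> powr (1 / p)"
      using L bound by (intro hoelder_of_quot_bound) auto
    also have "\<dots> \<le> L * ((\<epsilon> / (16 * L)) powr p) powr (1 / p)"
    proof (intro mult_left_mono powr_mono2)
      show "\<bar>x 0 - y 0\<bar> \<le> (\<epsilon> / (16 * L)) powr p"
        using close[of 0] powr_ge_zero[of "\<epsilon> / (16 * L)" p] unfolding \<delta>_def by linarith
    qed (use p L in auto)
    also have "\<dots> = \<epsilon> / 16"
      using p L \<epsilon> by (simp add: powr_powr)
    finally have "\<bar>f (x 0) - f (y 0)\<bar> \<le> \<epsilon> / 16" .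
    moreover have "bv_norm p (comp_op f x - comp_op f y)
        = \<bar>f (x 0) - f (y 0)\<bar> + (\<Sum>n. w n powr p) powr (1 / p)"
      by (simp add: bv_norm_def comp_op_def w_def algebra_simps)
    ultimately show ?thesis
      using variation \<epsilon> by linarith
  qed
  with \<delta> show "\<exists>\<delta>>0. \<forall>x\<in>B. \<forall>y\<in>B. bv_norm 1 (x - y) < \<delta> \<longrightarrow>
      bv_norm p (comp_op f x - comp_op f y) < \<epsilon>"
    by blast
qed

theorem theorem19:
  fixes p :: real and f :: "real \<Rightarrow> real"
  assumes "1 \<le> p"
    and "quasi_cont_diff (1 / p) f"
  shows "comp_op f ` bv 1 \<subseteq> bv p \<and>
    locally_uniformly_continuous (bv 1) (bv_norm 1) (bv_norm p) (comp_op f)"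
  by (intro conjI image_subsetI comp_op_mem_bv comp_op_locally_uniformly_continuous assms)

end
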